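(* Let $\mathcal{P}$ be a finite locally branched lattice given as a meet semi-sublattice of the boolean lattice $B_n$. Let $I$ (the "ignored sets") be a list of subsets of $\{1,\dots,n\}$, let $J$ (the "ignored atoms") be a subset of $\{1,\dots,n\}$, and let $C$ be the list of those coatoms of $\mathcal{P}$ that are not contained in any element of $I$. Then the algorithm FaceIterator, called with input $(C,I,J)$, outputs exactly once each element $p\in\mathcal{P}$, $p\neq\hat 1$, such that $p$ is not contained in any of the sets in $I$ and $p$ does not contain any element of $J$, and it outputs nothing else.
   Context: A finite lattice (or poset) is locally branched if for every saturated chain $a\prec b\prec c$ (where $\prec$ denotes the cover relation) there is an element $d\neq b$ with $a<d<c$. $B_n$ is the lattice of all subsets of $\{1,\dots,n\}$ ordered by inclusion. That $\mathcal{P}$ is given as a meet semi-sublattice of $B_n$ means: the atoms of $\mathcal{P}$ are $\{1\},\dots,\{n\}$ (identified with $1,\dots,n$), each element $p\in\mathcal{P}$ is identified with the set of atoms below it, the order is inclusion, and meets are intersections. $\hat 0,\hat 1$ are the lower and upper bounds of $\mathcal{P}$; coatoms are the lower covers of $\hat 1$. Algorithm FaceIterator$(C,I,J)$, where $C$ is a list (without repetitions) of subsets of $\{1,\dots,n\}$, $I$ is a list of subsets of $\{1,\dots,n\}$, and $J\subseteq\{1,\dots,n\}$. If $C$ is empty, stop. Otherwise: 1. Let $a$ be the first element of $C$. 2. If $a\cap J=\emptyset$, output $a$. 3. Let $N_1=\{a\cap b : b\in C,\ b\neq a\}$, let $N_2=\{x\in N_1 : x\not\subseteq y \text{ for all }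 y\in I\}$, and let $N$ be the list (without repetitions) of inclusion-maximal elements of $N_2$. 4. Call FaceIterator$(N, I, J)$ with a copy of $I$ (so that later changes made to $I$ inside this call do not affect the current $I$). 5. Let $C'=\{x\in C : x\not\subseteq a\cup J\}$ and append $a\cup J$ to $I$. 6. Call FaceIterator$(C', I, J)$. *)

theory Defs
  imports "HOL-Algebra.Lattice" "HOL-Combinatorics.Multiset_Permutations"
begin

definition covers :: "('a, 'b) gorder_scheme \<Rightarrow> 'a \<Rightarrow> 'a \<Rightarrow> bool" where
  "covers L a b \<longleftrightarrow> a \<in> carrier L \<and> b \<in> carrier L \<and> a \<sqsubset>\<^bsub>L\<^esub> b \<and>
     \<not> (\<exists>c\<in>carrier L. a \<sqsubset>\<^bsub>L\<^esub> c \<and> c \<sqsubset>\<^bsub>L\<^esub> b)"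

definition atoms :: "('a, 'b) gorder_scheme \<Rightarrow> 'a set" where
  "atoms L = {a. covers L \<bottom>\<^bsub>L\<^esub> a}"

definition coatoms :: "('a, 'b) gorder_scheme \<Rightarrow> 'a set" where
  "coatoms L = {c. covers L c \<top>\<^bsub>L\<^esub>}"

definition locally_branched :: "('a, 'b) gorder_scheme \<Rightarrow> bool" where
  "locally_branched L \<longleftrightarrow> (\<forall>a b c. covers L a b \<and> covers L b c \<longrightarrow>
     (\<exists>d\<in>carrier L. d \<noteq> b \<and> a \<sqsubset>\<^bsub>L\<^esub> d \<and> d \<sqsubset>\<^bsub>L\<^esub> c))"

definition inclusion_order :: "'a set set \<Rightarrow> 'a set gorder" where
  "inclusion_order P = \<lparr>carrier = P, eq = (=), le = (\<subseteq>)\<rparr>"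

text \<open>
  A finite lattice given as a meet semi-sublattice of the boolean lattice of subsets of
  \<open>{1..n}\<close>. Each element is the set of atoms below it: once the atoms are exactly the
  singletons \<open>{i}\<close>, the atoms below \<open>p\<close> are the \<open>{i}\<close> with
  \<open>i \<in> p\<close>, so this is implicit in the order being inclusion. Joins need not be unions.
\<close>
definition boolean_meet_semi_sublattice :: "nat \<Rightarrow> nat set set \<Rightarrow> bool" where
  "boolean_meet_semi_sublattice n P \<longleftrightarrow>
     P \<subseteq> Pow {1..n} \<and>
     bounded_lattice (inclusion_order P) \<and>
     atoms (inclusion_order P) = {{i} | i. i \<in> {1..n}} \<and>
     (\<forall>p\<in>P. \<forall>q\<in>P. p \<sqinter>\<^bsub>inclusion_order P\<^esub> q = p \<inter> q)"

text \<open>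
  The sets \<open>N\<^sub>1\<close>, \<open>N\<^sub>2\<close>, \<open>N\<close> and \<open>C'\<close> of the algorithm, for the first element \<open>a\<close> of \<open>C\<close>.
\<close>

definition FI_meets :: "'a set list \<Rightarrow> 'a set \<Rightarrow> 'a set set" where
  "FI_meets C a = {a \<inter> b | b. b \<in> set C \<and> b \<noteq> a}"

definition FI_not_ignored :: "'a set list \<Rightarrow> 'a set list \<Rightarrow> 'a set \<Rightarrow> 'a set set" where
  "FI_not_ignored C I a = {x \<in> FI_meets C a. \<forall>y\<in>set I. \<not> x \<subseteq> y}"

definition FI_maximal :: "'a set list \<Rightarrow> 'a set list \<Rightarrow> 'a set \<Rightarrow> 'a set set" where
  "FI_maximal C I a =
     {x \<in> FI_not_ignored C I a. \<not> (\<exists>y\<in>FI_not_ignored C I a. x \<subset> y)}"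

definition FI_remaining :: "'a set list \<Rightarrow> 'a set \<Rightarrow> 'a set \<Rightarrow> 'a set set" where
  "FI_remaining C J a = {x \<in> set C. \<not> x \<subseteq> a \<union> J}"

lemma length_FI_maximal:
  assumes "N \<in> permutations_of_set (FI_maximal (a # C) I a)"
  shows "length N < length (a # C)"
proof -
  have "set N \<subseteq> (\<lambda>b. a \<inter> b) ` set C"
    using assms unfolding permutations_of_set_def FI_maximal_def FI_not_ignored_def FI_meets_def
    by auto
  moreover have "length N = card (set N)"
    using assms by (metis permutations_of_setD distinct_card)
  ultimately have "length N \<le> card (set C)"
    by (metis List.finite_set surj_card_le)
  then show ?thesis
    using card_length[of C] by simp
qed

lemma length_FI_remaining:
  assumes "C' \<in> permutations_of_set (FI_remaining (a # C) J a)"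
  shows "length C' < length (a # C)"
proof -
  have "set C' \<subseteq> set C"
    using assms unfolding permutations_of_set_def FI_remaining_def by auto
  moreover have "length C' = card (set C')"
    using assms by (metis permutations_of_setD distinct_card)
  ultimately have "length C' \<le> card (set C)"
    by (metis List.finite_set card_mono)
  then show ?thesis
    using card_length[of C] by simp
qed

lemmas [fundef_cong] = SUP_cong

text \<open>
  \<open>face_iterator C I J\<close> is the set of all output sequences that the algorithm can produce.
  The algorithm does not specify the order of the lists it passes to its recursive calls, so
  every repetition-free arrangement (\<^const>\<open>permutations_of_set\<close>) is allowed, independently at
  each call. The recursion is well-founded over all arrangements, so every run terminates.
\<close>
function face_iterator :: "'a set list \<Rightarrow> 'a set list \<Rightarrow> 'a set \<Rightarrow> 'a set list set" where
  "face_iterator [] I J = {[]}"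
| "face_iterator (a # C) I J =
     (\<Union>N \<in> permutations_of_set (FI_maximal (a # C) I a).
      \<Union>C' \<in> permutations_of_set (FI_remaining (a # C) J a).
        {(if a \<inter> J = {} then [a] else []) @ us @ vs | us vs.
           us \<in> face_iterator N I J \<and> vs \<in> face_iterator C' (I @ [a \<union> J]) J})"
  by pat_completeness auto
termination
  by (relation "measure (\<lambda>(C, I, J). length C)")
    (use length_FI_maximal length_FI_remaining in \<open>auto simp del: length_Cons\<close>)

end

theory Submission
  imports Defs
begin

text \<open>
  The recursion preserves that \<open>C\<close> consists of the non-ignored lower covers of one fixed \<open>t \<in> P\<close>:
  \<open>t\<close> is unchanged in the second call and becomes \<open>a\<close> in the first. For the first call, a lower cover
  \<open>x\<close> of \<open>a\<close> satisfies \<open>x \<prec> a \<prec> t\<close>, so local branching gives \<open>d \<noteq> a\<close> strictly between \<open>x\<close> and \<open>t\<close>;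
  any lower cover \<open>b\<close> of \<open>t\<close> above \<open>d\<close> is different from \<open>a\<close> and \<open>x = a \<inter> b\<close>. The first call outputs
  faces strictly below \<open>a\<close>, the second call only faces not contained in \<open>a \<union> J\<close>; for a face disjoint
  from \<open>J\<close> the latter means not being contained in \<open>a\<close>.
\<close>

lemma inclusion_order_simps [simp]:
  "carrier (inclusion_order P) = P"
  "x \<sqsubset>\<^bsub>inclusion_order P\<^esub> y \<longleftrightarrow> x \<subset> y"
  by (auto simp: inclusion_order_def lless_def)

lemma covers_inclusion_order_iff:
  "covers (inclusion_order P) x y \<longleftrightarrow>
     x \<in> P \<and> y \<in> P \<and> x \<subset> y \<and> \<not> (\<exists>z\<in>P. x \<subset> z \<and> z \<subset> y)"
  by (simp add: covers_def)

lemma eq_if_between_covers: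
  assumes "covers (inclusion_order P) x y" "z \<in> P" "x \<subseteq> z" "z \<subset> y"
  shows "z = x"
  using assms unfolding covers_inclusion_order_iff by (metis psubsetI)

lemma lower_covers_antichain:
  assumes "covers (inclusion_order P) x t" "covers (inclusion_order P) y t" "x \<subseteq> y"
  shows "y = x"
  using eq_if_between_covers[OF assms(1) _ assms(3)] assms(2)
  by (simp add: covers_inclusion_order_iff)

lemma lower_cover_above:
  assumes "finite P" "p \<in> P" "t \<in> P" "p \<subset> t"
  obtains c where "covers (inclusion_order P) c t" "p \<subseteq> c"
proof -
  have "finite {x \<in> P. x \<subset> t}" "p \<in> {x \<in> P. x \<subset> t}"
    using assms by auto
  from finite_has_maximal2[OF this] obtain c where
    c: "c \<in> P" "c \<subset> t" "p \<subseteq> c" and max: "\<forall>x\<in>{x \<in> P. x \<subset> t}. c \<subseteq> x \<longrightarrow> c = x"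
    by (metis (lifting) mem_Collect_eq)
  have "\<not> (\<exists>z\<in>P. c \<subset> z \<and> z \<subset> t)"
    using max by auto
  with c \<open>t \<in> P\<close> have "covers (inclusion_order P) c t"
    by (simp add: covers_inclusion_order_iff)
  then show thesis using c that by blast
qed

text \<open>A lower cover that meets \<open>J\<close> can still have faces disjoint from
  \<open>J\<close> below it, so meeting \<open>J\<close> is no reason to drop it. Disjointness from
  \<open>J\<close> is demanded only of the output, in \<open>faces_below\<close>.\<close>

definition relevant_lower_covers :: "'a set set \<Rightarrow> 'a set \<Rightarrow> 'a set list \<Rightarrow> 'a set set" where
  "relevant_lower_covers P t I =
     {c. covers (inclusion_order P) c t \<and> (\<forall>S\<in>set I. \<not> c \<subseteq> S)}"

definition faces_below :: "'a set set \<Rightarrow> 'a set \<Rightarrow> 'a set list \<Rightarrow> 'a set \<Rightarrow> 'a set set" where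
  "faces_below P t I J = {p \<in> P. p \<subset> t \<and> (\<forall>S\<in>set I. \<not> p \<subseteq> S) \<and> p \<inter> J = {}}"

lemma lower_cover_eq_Int:
  assumes "finite P" and Int: "\<forall>p\<in>P. \<forall>q\<in>P. p \<inter> q \<in> P"
    and branched: "locally_branched (inclusion_order P)"
    and xa: "covers (inclusion_order P) x a" and at: "covers (inclusion_order P) a t"
  obtains b where "covers (inclusion_order P) b t" "b \<noteq> a" "x = a \<inter> b"
proof -
  have "\<exists>d\<in>P. d \<noteq> a \<and> x \<subset> d \<and> d \<subset> t"
    using branched[unfolded locally_branched_def inclusion_order_simps, rule_format, OF conjI, OF xa at] .
  then obtain d where d: "d \<in> P" "d \<noteq> a" "x \<subset> d" "d \<subset> t"
    by (elim bexE conjE)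
  have "t \<in> P" using at by (simp add: covers_inclusion_order_iff)
  obtain b where b: "covers (inclusion_order P) b t" "d \<subseteq> b"
    using lower_cover_above[OF \<open>finite P\<close> \<open>d \<in> P\<close> \<open>t \<in> P\<close> \<open>d \<subset> t\<close>] .
  \<comment> \<open>Otherwise \<open>d\<close> would lie strictly between \<open>x\<close> and its
    cover \<open>a\<close>.\<close>
  have "b \<noteq> a"
  proof
    assume "b = a"
    with b(2) \<open>d \<noteq> a\<close> have "d \<subset> a" by blast
    with eq_if_between_covers[OF xa \<open>d \<in> P\<close>] \<open>x \<subset> d\<close> show False by blast
  qed
  \<comment> \<open>Distinct lower covers of \<open>t\<close> are incomparable, so the intersection
    is proper. As an element of \<open>P\<close> that contains \<open>x\<close> and lies strictly
    below \<open>a\<close>, it can only be \<open>x\<close>.\<close>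
  then have "a \<inter> b \<subset> a"
    using lower_covers_antichain[OF at b(1)] by blast
  moreover have "a \<inter> b \<in> P"
    using Int b(1) at by (simp add: covers_inclusion_order_iff)
  moreover have "x \<subset> a"
    using xa by (simp add: covers_inclusion_order_iff)
  then have "x \<subseteq> a \<inter> b"
    using b(2) \<open>x \<subset> d\<close> by blast
  ultimately have "x = a \<inter> b"
    using eq_if_between_covers[OF xa, of "a \<inter> b"] by simp
  with b(1) \<open>b \<noteq> a\<close> show thesis using that by blast
qed

text \<open>The candidates \<open>?M\<close> are squeezed between two families: they include all
  non-ignored lower covers of \<open>a\<close>, and they all are non-ignored elements of
  \<open>P\<close> strictly below \<open>a\<close>. Each member of the larger family lies under a
  member of the smaller one, which is an antichain, so the maximal candidates are exactly the
  smaller family.\<close>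

lemma FI_maximal_eq_relevant_lower_covers:
  assumes "finite P" and Int: "\<forall>p\<in>P. \<forall>q\<in>P. p \<inter> q \<in> P"
    and branched: "locally_branched (inclusion_order P)"
    and C: "set C = relevant_lower_covers P t I" and "a \<in> set C"
  shows "FI_maximal C I a = relevant_lower_covers P a I"
proof -
  let ?M = "FI_not_ignored C I a"
  have at: "covers (inclusion_order P) a t"
    using C \<open>a \<in> set C\<close> by (simp add: relevant_lower_covers_def)
  have below: "x \<in> P \<and> x \<subset> a \<and> (\<forall>S\<in>set I. \<not> x \<subseteq> S)" if "x \<in> ?M" for x
  proof -
    obtain b where b: "b \<in> set C" "b \<noteq> a" "x = a \<inter> b" and I: "\<forall>S\<in>set I. \<not> x \<subseteq> S"
      using \<open>x \<in> ?M\<close> unfolding FI_not_ignored_def FI_meets_def by blast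
    have bt: "covers (inclusion_order P) b t"
      using C b(1) by (simp add: relevant_lower_covers_def)
    have "\<not> a \<subseteq> b"
      using lower_covers_antichain[OF at bt] b(2) by blast
    moreover have "x \<in> P"
      using Int bt at b(3) by (simp add: covers_inclusion_order_iff)
    ultimately show ?thesis using b(3) I by blast
  qed
  have lower_covers: "relevant_lower_covers P a I \<subseteq> ?M"
  proof
    fix x assume x: "x \<in> relevant_lower_covers P a I"
    then have xa: "covers (inclusion_order P) x a" and I: "\<forall>S\<in>set I. \<not> x \<subseteq> S"
      by (auto simp: relevant_lower_covers_def)
    obtain b where b: "covers (inclusion_order P) b t" "b \<noteq> a" "x = a \<inter> b"
      using lower_cover_eq_Int[OF \<open>finite P\<close> Int branched xa at] .
    \<comment> \<open>A set in \<open>I\<close> containing \<open>b\<close> would also contain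
      \<open>x\<close>; hence the lower cover \<open>b\<close> needed to produce \<open>x\<close>
      has not been discarded from \<open>C\<close>.\<close>
    have "\<forall>S\<in>set I. \<not> b \<subseteq> S"
      using I b(3) by (metis le_infI2)
    with b(1) have "b \<in> set C"
      by (simp add: C relevant_lower_covers_def)
    then show "x \<in> ?M"
      using b I unfolding FI_not_ignored_def FI_meets_def by blast
  qed
  show ?thesis
  proof
    show "relevant_lower_covers P a I \<subseteq> FI_maximal C I a"
    proof
      fix x assume x: "x \<in> relevant_lower_covers P a I"
      then have xa: "covers (inclusion_order P) x a"
        by (simp add: relevant_lower_covers_def)
      have "\<not> x \<subset> y" if "y \<in> ?M" for y
        using eq_if_between_covers[OF xa, of y] below[OF that] by auto
      with x lower_covers show "x \<in> FI_maximal C I a"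
        unfolding FI_maximal_def by blast
    qed
  next
    show "FI_maximal C I a \<subseteq> relevant_lower_covers P a I"
    proof
      fix x assume "x \<in> FI_maximal C I a"
      then have x: "x \<in> ?M" and max: "\<And>y. y \<in> ?M \<Longrightarrow> \<not> x \<subset> y"
        by (auto simp: FI_maximal_def)
      note x_below = below[OF x]
      have "a \<in> P" using at by (simp add: covers_inclusion_order_iff)
      \<comment> \<open>This \<open>c\<close> inherits from its subset \<open>x\<close> that it is
        not ignored, so it is a candidate too, and maximality of \<open>x\<close> forces
        \<open>x = c\<close>.\<close>
      then obtain c where c: "covers (inclusion_order P) c a" "x \<subseteq> c"
        using lower_cover_above \<open>finite P\<close> x_below by metis
      then have "c \<in> relevant_lower_covers P a I"
        using x_below unfolding relevant_lower_covers_def by blast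
      with max[of c] c(2) lower_covers show "x \<in> relevant_lower_covers P a I" by blast
    qed
  qed
qed

text \<open>Filtering the list by \<open>a \<union> J\<close> has the same effect as adding this set
  to the ignored ones, so the invariant survives with the same \<open>t\<close>.\<close>

lemma FI_remaining_eq_relevant_lower_covers:
  assumes "set C = relevant_lower_covers P t I"
  shows "FI_remaining C J a = relevant_lower_covers P t (I @ [a \<union> J])"
  using assms by (auto simp: FI_remaining_def relevant_lower_covers_def)

text \<open>This is the base case of the recursion: a lower cover of \<open>t\<close> above a
  non-ignored face is itself not ignored.\<close>

lemma faces_below_eq_empty:
  assumes "finite P" "t \<in> P" "relevant_lower_covers P t I = {}"
  shows "faces_below P t I J = {}"
proof (rule ccontr)
  assume "faces_below P t I J \<noteq> {}"
  then obtain p where p: "p \<in> P" "p \<subset> t" "\<forall>S\<in>set I. \<not> p \<subseteq> S"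
    unfolding faces_below_def by blast
  obtain c where "covers (inclusion_order P) c t" "p \<subseteq> c"
    using lower_cover_above[OF \<open>finite P\<close> \<open>p \<in> P\<close> \<open>t \<in> P\<close> \<open>p \<subset> t\<close>] .
  with p(3) have "c \<in> relevant_lower_covers P t I"
    unfolding relevant_lower_covers_def by blast
  with assms(3) show False by simp
qed

text \<open>A face equals \<open>a\<close>, lies strictly below \<open>a\<close>, or is not
  contained in \<open>a\<close>. These cases match the three sources of output in one round of the
  algorithm.\<close>

lemma faces_below_split:
  assumes "a \<in> relevant_lower_covers P t I"
  shows "faces_below P t I J =
    (if a \<inter> J = {} then {a} else {}) \<union> faces_below P a I J \<union> faces_below P t (I @ [a \<union> J]) J"
proof -
  have "a \<in> P" "a \<subset> t" "\<forall>S\<in>set I. \<not> a \<subseteq> S"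
    using assms by (auto simp: relevant_lower_covers_def covers_inclusion_order_iff)
  then show ?thesis
    unfolding faces_below_def by (auto split: if_splits)
qed

text \<open>This rules out that a claim about all output sequences holds vacuously. Arrangements
  exist at each call because the sets to be listed are finite.\<close>

lemma face_iterator_nonempty: "face_iterator C I J \<noteq> {}"
proof (induction C I J rule: face_iterator.induct)
  case (2 a C I J)
  have "finite (FI_maximal (a # C) I a)" "finite (FI_remaining (a # C) J a)"
    unfolding FI_maximal_def FI_not_ignored_def FI_meets_def FI_remaining_def by simp_all
  then obtain N C' where N: "N \<in> permutations_of_set (FI_maximal (a # C) I a)"
    and C': "C' \<in> permutations_of_set (FI_remaining (a # C) J a)"
    by (meson ex_in_conv permutations_of_set_empty_iff)
  from "2.IH"(1)[OF N C'] "2.IH"(2)[OF N C'] obtain us vs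
    where "us \<in> face_iterator N I J" "vs \<in> face_iterator C' (I @ [a \<union> J]) J"
    by blast
  with N C' show ?case
    unfolding face_iterator.simps by blast
qed simp

lemma face_iterator_outputs_faces_below:
  assumes "finite P" and Int: "\<forall>p\<in>P. \<forall>q\<in>P. p \<inter> q \<in> P"
    and branched: "locally_branched (inclusion_order P)"
    and "t \<in> P" "set C = relevant_lower_covers P t I" "out \<in> face_iterator C I J"
  shows "distinct out \<and> set out = faces_below P t I J"
  using assms(4-6)
\<comment> \<open>The element \<open>t\<close> has to vary, since the hypothesis for the first call
  is used with \<open>a\<close> in its place.\<close>
proof (induction C I J arbitrary: t out rule: face_iterator.induct)
  case (1 I J)
  then show ?case using faces_below_eq_empty[OF \<open>finite P\<close>] by auto
next
  case (2 a C I J)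
  from "2.prems"(3) obtain N C' us vs
    where N: "N \<in> permutations_of_set (FI_maximal (a # C) I a)"
      and C': "C' \<in> permutations_of_set (FI_remaining (a # C) J a)"
      and us: "us \<in> face_iterator N I J" and vs: "vs \<in> face_iterator C' (I @ [a \<union> J]) J"
      and out: "out = (if a \<inter> J = {} then [a] else []) @ us @ vs"
    by auto
  have a: "a \<in> relevant_lower_covers P t I"
    using "2.prems"(2) by auto
  then have "a \<in> P"
    by (simp add: relevant_lower_covers_def covers_inclusion_order_iff)
  have "set N = relevant_lower_covers P a I"
    using FI_maximal_eq_relevant_lower_covers[OF \<open>finite P\<close> Int branched "2.prems"(2)]
      permutations_of_setD(1)[OF N] by simp
  with "2.IH"(1)[OF N C' \<open>a \<in> P\<close> _ us] have us': "distinct us" "set us = faces_below P a I J"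
    by blast+
  have "set C' = relevant_lower_covers P t (I @ [a \<union> J])"
    using FI_remaining_eq_relevant_lower_covers[OF "2.prems"(2)]
      permutations_of_setD(1)[OF C'] by simp
  with "2.IH"(2)[OF N C' \<open>t \<in> P\<close> _ vs]
  have vs': "distinct vs" "set vs = faces_below P t (I @ [a \<union> J]) J"
    by blast+
  have "distinct out"
  proof -
    \<comment> \<open>Members of \<open>us\<close> are proper subsets of \<open>a\<close>, whereas
      members of \<open>vs\<close> are not contained in the newly ignored set
      \<open>a \<union> J\<close>; \<open>a\<close> itself is neither.\<close>
    have "a \<notin> set us \<union> set vs" "set us \<inter> set vs = {}"
      unfolding us'(2) vs'(2) faces_below_def by auto
    then show ?thesis
      unfolding out using us'(1) vs'(1) by simp
  qed
  moreover have "set out = faces_below P t I J"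
    unfolding out faces_below_split[OF a] using us'(2) vs'(2) by auto
  ultimately show ?case by blast
qed

theorem theorem3p6:
  fixes n :: nat and P :: "nat set set" and C I :: "nat set list" and J :: "nat set"
  assumes "boolean_meet_semi_sublattice n P"
    and "locally_branched (inclusion_order P)"
    and "\<forall>S\<in>set I. S \<subseteq> {1..n}"
    and "J \<subseteq> {1..n}"
    and "distinct C"
    and "set C = {c \<in> coatoms (inclusion_order P). \<forall>S\<in>set I. \<not> c \<subseteq> S}"
  shows "face_iterator C I J \<noteq> {} \<and>
    (\<forall>out \<in> face_iterator C I J. distinct out \<and>
      set out = {p \<in> P. p \<noteq> \<top>\<^bsub>inclusion_order P\<^esub> \<and> (\<forall>S\<in>set I. \<not> p \<subseteq> S) \<and> (\<forall>j\<in>J. j \<notin> p)})"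
proof -
  let ?L = "inclusion_order P"
  interpret bounded_lattice ?L
    using assms(1) by (simp add: boolean_meet_semi_sublattice_def)
  have "P \<subseteq> Pow {1..n}"
    using assms(1) by (simp add: boolean_meet_semi_sublattice_def)
  then have "finite P" by (rule finite_subset) simp
  \<comment> \<open>The hypothesis only identifies lattice meets with intersections; that these lie
    in \<open>P\<close> comes from closure of the lattice under meets.\<close>
  have Int: "\<forall>p\<in>P. \<forall>q\<in>P. p \<inter> q \<in> P"
  proof (intro ballI)
    fix p q assume "p \<in> P" "q \<in> P"
    then show "p \<inter> q \<in> P"
      using assms(1) meet_closed[of p q] by (simp add: boolean_meet_semi_sublattice_def)
  qed
  have top: "\<top>\<^bsub>?L\<^esub> \<in> P" "\<And>p. p \<in> P \<Longrightarrow> p \<subseteq> \<top>\<^bsub>?L\<^esub>"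
    using top_closed top_higher by (simp_all add: inclusion_order_def)
  \<comment> \<open>Coatoms are the lower covers of the top element, so the invariant holds
    initially with \<open>t\<close> the top.\<close>
  have C: "set C = relevant_lower_covers P \<top>\<^bsub>?L\<^esub> I"
    using assms(6) by (simp add: coatoms_def relevant_lower_covers_def)
  have "faces_below P \<top>\<^bsub>?L\<^esub> I J =
      {p \<in> P. p \<noteq> \<top>\<^bsub>?L\<^esub> \<and> (\<forall>S\<in>set I. \<not> p \<subseteq> S) \<and> (\<forall>j\<in>J. j \<notin> p)}"
    using top(2) unfolding faces_below_def by blast
  moreover have "distinct out \<and> set out = faces_below P \<top>\<^bsub>?L\<^esub> I J"
    if "out \<in> face_iterator C I J" for out
    by (rule face_iterator_outputs_faces_below[OF \<open>finite P\<close> Int assms(2) top(1) C that])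
  ultimately show ?thesis
    using face_iterator_nonempty by simp
qed

end
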